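(* Let $m$ be a quasi-Bernoulli measure on $[0,1)^D$ with dimension $d=-\tau'(1)$. Suppose that there exists a real $\sigma>0$ such that $\tau(1-q)=qd+\frac{\sigma^2}{2}q^2+o(q^2)$ in a neighborhood of $q=0$. Then, $m$-almost surely, $$\limsup_{n\to+\infty}\frac{S_n-nd}{\sqrt n}=+\infty\qquad\text{and}\qquad\liminf_{n\to+\infty}\frac{S_n-nd}{\sqrt n}=-\infty.$$
   Context: Fix integers $D\ge1$, $\ell\ge2$. $\mathcal F_n$ is the family of $\ell$-adic cubes $\prod_{i=1}^D[k_i/\ell^n,(k_i+1)/\ell^n)$, $0\le k_i<\ell^n$. For each $n$ the cubes of $\mathcal F_n$ are coded bijectively as $I_{\varepsilon_1\cdots\varepsilon_n}$, $\varepsilon_i\in\{0,\dots,\ell^D-1\}$, with $I_{\varepsilon_1\cdots\varepsilon_{n+1}}\subset I_{\varepsilon_1\cdots\varepsilon_n}$. For $I=I_{\varepsilon_1\cdots\varepsilon_n}\in\mathcal F_n$ and $J=I_{\varepsilon_{n+1}\cdots\varepsilon_{n+p}}\in\mathcal F_p$, let $IJ=I_{\varepsilon_1\cdots\varepsilon_{n+p}}\in\mathcal F_{n+p}$. A Borel probability measure $m$ on $[0,1)^D$ is quasi-Bernoulli if there is a constant $C\ge1$ with $\frac1Cm(I)m(J)\le m(IJ)\le C\,m(I)m(J)$ for all $I,J\in\bigcup_n\mathcal F_n$. The $L^q$-spectrum is $\tau(q)=\limsup_{n\to\infty}\frac{1}{n\log\ell}\log\left(\sum_{I\in\mathcal F_n}m(I)^q\right)$,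 $q\in\mathbb R$ (sum over cubes with $m(I)>0$). For quasi-Bernoulli $m$ it is known that $\tau$ is convex and $C^1$ on $\mathbb R$, and that $d=-\tau'(1)$ is the dimension of $m$. $I_n(x)$ is the cube of $\mathcal F_n$ containing $x$, and $S_n(x)=-\log_\ell m(I_n(x))$. *)

theory Defs
  imports "HOL-Probability.Probability" "HOL-Library.Landau_Symbols"
begin

text \<open>The dimension \<open>D\<close> is \<open>CARD('d)\<close> throughout.\<close>

definition unit_cube :: "(real ^ 'd) set" where
  "unit_cube = {x. \<forall>i. 0 \<le> x $ i \<and> x $ i < 1}"

definition cubes :: "nat \<Rightarrow> nat \<Rightarrow> (real ^ 'd) set set" where
  "cubes l n =
    {{x. \<forall>i. real (k i) / real l ^ n \<le> x $ i \<and> x $ i < (real (k i) + 1) / real l ^ n} | k :: 'd \<Rightarrow> nat.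
      \<forall>i. k i < l ^ n}"

definition words :: "'d itself \<Rightarrow> nat \<Rightarrow> nat list set" where
  "words TYPE('d) l = lists {..<l ^ CARD('d)}"

definition cube_coding :: "nat \<Rightarrow> (nat list \<Rightarrow> (real ^ 'd) set) \<Rightarrow> bool" where
  "cube_coding l c \<longleftrightarrow>
    (\<forall>n. bij_betw c {w \<in> words TYPE('d) l. length w = n} (cubes l n)) \<and>
    (\<forall>w a. w @ [a] \<in> words TYPE('d) l \<longrightarrow> c (w @ [a]) \<subseteq> c w)"

definition borel_prob_unit_cube :: "(real ^ 'd) measure \<Rightarrow> bool" where
  "borel_prob_unit_cube m \<longleftrightarrow> prob_space m \<and> sets m = sets (restrict_space borel unit_cube)"

text \<open>
  Since a coding is bijective at every generation, a pair of cubes \<open>I\<close>, \<open>J\<close> is a pair of words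
  \<open>u\<close>, \<open>v\<close>, and the cube \<open>IJ\<close> is the one coded by \<open>u @ v\<close>.
\<close>
definition quasi_bernoulli ::
    "nat \<Rightarrow> (nat list \<Rightarrow> (real ^ 'd) set) \<Rightarrow> (real ^ 'd) measure \<Rightarrow> bool" where
  "quasi_bernoulli l c m \<longleftrightarrow>
    borel_prob_unit_cube m \<and>
    (\<exists>C\<ge>1. \<forall>u\<in>words TYPE('d) l. \<forall>v\<in>words TYPE('d) l.
      1 / C * measure m (c u) * measure m (c v) \<le> measure m (c (u @ v)) \<and>
      measure m (c (u @ v)) \<le> C * measure m (c u) * measure m (c v))"

text \<open>
  The upper limit is taken in the extended reals; for a quasi-Bernoulli measure it is finite for
  every \<open>q\<close>, so the conversion back to the reals loses nothing.
\<close>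
definition Lq_spectrum :: "nat \<Rightarrow> (real ^ 'd) measure \<Rightarrow> real \<Rightarrow> real" where
  "Lq_spectrum l m q = real_of_ereal (limsup (\<lambda>n. ereal (
     1 / (real n * ln (real l)) *
     ln (\<Sum>I\<in>{I \<in> cubes l n. measure m I > 0}. measure m I powr q))))"

definition cube_at :: "nat \<Rightarrow> nat \<Rightarrow> real ^ 'd \<Rightarrow> (real ^ 'd) set" where
  "cube_at l n x = (THE I. I \<in> cubes l n \<and> x \<in> I)"

definition information :: "nat \<Rightarrow> (real ^ 'd) measure \<Rightarrow> nat \<Rightarrow> real ^ 'd \<Rightarrow> real" where
  "information l m n x = - log (real l) (measure m (cube_at l n x))"

end

theory Submission
  imports Defs
begin

text \<open>
  Write \<open>X\<^sub>n = (S\<^sub>n - n d) / \<surd>n\<close>.  Two consequences of the quasi-Bernoulli property carry the proof.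

  First, the partition sums \<open>Z\<^sub>n(q)\<close>, the sums of \<open>m(I)\<^sup>q\<close> over the cubes of generation \<open>n\<close>, are
  multiplicative in \<open>n\<close> up to a bounded factor.  Hence \<open>log\<^sub>l Z\<^sub>n(q)\<close> differs from \<open>n \<tau>(q)\<close> by an
  amount bounded in \<open>n\<close> (\<open>log_Z_near_spectrum\<close>).  Since \<open>Z\<^sub>n(1 - q)\<close> is the expectation of
  \<open>l\<close> to the power \<open>q S\<^sub>n\<close>, taking \<open>q = t / \<surd>n\<close> in the expansion of \<open>\<tau>\<close> shows that for
  large \<open>n\<close> each exponential moment of \<open>X\<^sub>n\<close> lies between those of two Gaussian variables, up to a
  factor that does not depend on the order \<open>t\<close> of the moment (\<open>gaussian_exp_moments\<close>).
  Such moments grow too fast in \<open>\<bar>t\<bar>\<close> for a variable with no mass beyond \<open>a\<close>, and a second moment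
  argument gives, for every \<open>a\<close>, a number
  \<open>\<delta> > 0\<close> with \<open>m(X\<^sub>n > a) \<ge> \<delta>\<close> and \<open>m(X\<^sub>n < - a) \<ge> \<delta>\<close> for all large \<open>n\<close>
  (\<open>tail_mass_bounded_below\<close>).

  Second, after a cube \<open>I\<close> of generation \<open>k\<close> the process starts afresh: replacing \<open>J\<close> by \<open>I J\<close>
  changes \<open>S\<^sub>n - n d\<close> by a bounded amount, invisible on the scale \<open>\<surd>n\<close>, and changes the measure by
  the factor \<open>m(I)\<close> up to the constant \<open>C\<close>.  So conditionally on any cube of positive measure the events above still
  have probability at least \<open>\<delta> / C\<close> for large \<open>n\<close> (\<open>conditional_tail_mass\<close>).  A point which avoids
  them from some time on must survive infinitely many rounds, in each of which at most the
  proportion \<open>1 - \<delta> / C\<close> of the remaining mass survives; this zero-one argument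
  (\<open>AE_visits_infinitely_often\<close>) shows that almost every point has \<open>X\<^sub>n > a\<close> and \<open>X\<^sub>n < - a\<close>
  infinitely often, for every \<open>a\<close>.
\<close>

section \<open>Inequalities for sequences, finite sums and powers\<close>

lemma almost_additive_multiple:
  fixes a :: "nat \<Rightarrow> real"
  assumes "\<And>n p. \<bar>a (n + p) - a n - a p\<bar> \<le> \<kappa>"
  shows "\<bar>a (Suc k * n) - real (Suc k) * a n\<bar> \<le> real k * \<kappa>"
proof (induction k)
  case (Suc k)
  have "a (Suc (Suc k) * n) - real (Suc (Suc k)) * a n
      = (a (n + Suc k * n) - a n - a (Suc k * n)) + (a (Suc k * n) - real (Suc k) * a n)"
    by (simp add: algebra_simps)
  then show ?case
    using Suc assms[of n "Suc k * n"] by (simp add: algebra_simps)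
qed simp

text \<open>
  Evaluating \<open>a (n * p)\<close> both as \<open>p\<close> copies of \<open>a n\<close> and as \<open>n\<close> copies of \<open>a p\<close> compares
  \<open>a n / n\<close> with \<open>a p / p\<close> up to \<open>\<kappa> / n + \<kappa> / p\<close>; then \<open>p\<close> tends to infinity.  The point is that
  the error in the conclusion does not grow with \<open>n\<close>.
\<close>
lemma almost_additive_limsup:
  fixes a :: "nat \<Rightarrow> real"
  assumes add: "\<And>n p. \<bar>a (n + p) - a n - a p\<bar> \<le> \<kappa>" and n: "n > 0"
  shows "\<bar>a n - real n * real_of_ereal (limsup (\<lambda>p. ereal (a p / real p)))\<bar> \<le> \<kappa>"
proof -
  let ?L = "limsup (\<lambda>p. ereal (a p / real p))"
  have kappa: "0 \<le> \<kappa>"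
    using add[of 0 0] by linarith
  have compare: "\<bar>a p / real p - a n / real n\<bar> \<le> \<kappa> / real n + \<kappa> / real p" if p: "p > 0" for p
  proof -
    obtain p' n' where p': "p = Suc p'" and n': "n = Suc n'"
      using p n by (metis gr0_implies_Suc)
    have "\<bar>a (p * n) - real p * a n\<bar> \<le> real p' * \<kappa>" "\<bar>a (n * p) - real n * a p\<bar> \<le> real n' * \<kappa>"
      using almost_additive_multiple[OF add, of p' n] almost_additive_multiple[OF add, of n' p]
      unfolding p' n' by blast+
    moreover have "real p' * \<kappa> \<le> real p * \<kappa>" "real n' * \<kappa> \<le> real n * \<kappa>"
      using kappa p' n' by (auto intro: mult_right_mono)
    ultimately have "\<bar>real n * a p - real p * a n\<bar> \<le> real p * \<kappa> + real n * \<kappa>"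
      by (simp add: mult.commute)
    moreover have "a p / real p - a n / real n = (real n * a p - real p * a n) / (real n * real p)"
      using p n by (simp add: field_simps)
    moreover have "\<kappa> / real n + \<kappa> / real p = (real p * \<kappa> + real n * \<kappa>) / (real n * real p)"
      using p n by (simp add: field_simps)
    ultimately show ?thesis
      using p n by (simp add: abs_divide abs_mult divide_right_mono)
  qed
  have lim_up: "(\<lambda>p. ereal (a n / real n + \<kappa> / real n + \<kappa> / real p)) \<longlonglongrightarrow> ereal (a n / real n + \<kappa> / real n + 0)"
    and lim_lo: "(\<lambda>p. ereal (a n / real n - \<kappa> / real n - \<kappa> / real p)) \<longlonglongrightarrow> ereal (a n / real n - \<kappa> / real n - 0)"
    by (intro tendsto_intros lim_const_over_n)+
  have "?L \<le> limsup (\<lambda>p. ereal (a n / real n + \<kappa> / real n + \<kappa> / real p))"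
    by (intro Limsup_mono eventually_sequentiallyI[of 1])
      (use compare in \<open>force simp: abs_le_iff algebra_simps\<close>)
  then have up: "?L \<le> ereal (a n / real n + \<kappa> / real n)"
    using lim_imp_Limsup[OF _ lim_up] by simp
  have "limsup (\<lambda>p. ereal (a n / real n - \<kappa> / real n - \<kappa> / real p)) \<le> ?L"
    by (intro Limsup_mono eventually_sequentiallyI[of 1])
      (use compare in \<open>force simp: abs_le_iff algebra_simps\<close>)
  then have lo: "ereal (a n / real n - \<kappa> / real n) \<le> ?L"
    using lim_imp_Limsup[OF _ lim_lo] by simp
  obtain r where r: "?L = ereal r"
    using up lo by (cases ?L) auto
  have "real n * (a n / real n - \<kappa> / real n) \<le> real n * r" "real n * r \<le> real n * (a n / real n + \<kappa> / real n)"
    using up lo unfolding r by (auto intro: mult_left_mono)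
  then show ?thesis
    unfolding r using n by (simp add: algebra_simps abs_le_iff)
qed

text \<open>
  The values of \<open>z\<close> below \<open>b\<close> account for at most \<open>b\<close> of the mean, hence the values above \<open>b\<close> for at
  least as much, and the Cauchy-Schwarz inequality bounds their share by the second moment.
\<close>
lemma second_moment_tail:
  fixes p z :: "'a \<Rightarrow> real"
  assumes fin: "finite A" and p: "\<And>w. w \<in> A \<Longrightarrow> 0 \<le> p w" and tot: "sum p A \<le> 1"
    and b: "0 \<le> b" and mean: "2 * b \<le> (\<Sum>w\<in>A. p w * z w)"
  shows "b\<^sup>2 \<le> (\<Sum>w\<in>A. p w * (z w)\<^sup>2) * sum p {w \<in> A. b < z w}"
proof -
  let ?T = "{w \<in> A. b < z w}"
  have "(\<Sum>w\<in>A - ?T. p w * z w) \<le> (\<Sum>w\<in>A - ?T. p w * b)"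
    by (rule sum_mono) (auto intro: mult_left_mono p)
  also have "\<dots> = sum p (A - ?T) * b"
    by (simp add: sum_distrib_right)
  also have "\<dots> \<le> sum p A * b"
    using fin p b by (intro mult_right_mono sum_mono2) auto
  also have "\<dots> \<le> 1 * b"
    using tot b by (rule mult_right_mono)
  finally have "b \<le> (\<Sum>w\<in>?T. p w * z w)"
    using mean sum.subset_diff[of ?T A "\<lambda>w. p w * z w"] fin by force
  then have "b\<^sup>2 \<le> (\<Sum>w\<in>?T. p w * z w)\<^sup>2"
    using b by (rule power_mono)
  also have "(\<Sum>w\<in>?T. p w * z w) = (\<Sum>w\<in>?T. (sqrt (p w) * z w) * sqrt (p w))"
    using p by (intro sum.cong) (auto simp: mult.assoc mult.left_commute)
  also have "(\<Sum>w\<in>?T. (sqrt (p w) * z w) * sqrt (p w))\<^sup>2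
      \<le> (\<Sum>w\<in>?T. (sqrt (p w) * z w)\<^sup>2) * (\<Sum>w\<in>?T. (sqrt (p w))\<^sup>2)"
    by (rule Cauchy_Schwarz_ineq_sum)
  also have "\<dots> = (\<Sum>w\<in>?T. p w * (z w)\<^sup>2) * sum p ?T"
    using p by (auto simp: power_mult_distrib intro!: arg_cong2[of _ _ _ _ "(*)"] sum.cong)
  also have "\<dots> \<le> (\<Sum>w\<in>A. p w * (z w)\<^sup>2) * sum p ?T"
    using fin p by (intro mult_right_mono sum_mono2 sum_nonneg) auto
  finally show ?thesis .
qed

lemma powr_within_factor:
  fixes x y C q :: real
  assumes "0 < x" "0 < y" "1 \<le> C" and lo: "y / C \<le> x" and up: "x \<le> C * y"
  shows "x powr q \<le> C powr \<bar>q\<bar> * y powr q"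
proof (cases "0 \<le> q")
  case True
  then have "x powr q \<le> (C * y) powr q"
    using assms by (intro powr_mono2) auto
  then show ?thesis using True assms by (simp add: powr_mult)
next
  case False
  then have "x powr q \<le> (y / C) powr q"
    using assms by (intro powr_mono2') auto
  also have "\<dots> = C powr \<bar>q\<bar> * y powr q"
    using False assms by (simp add: powr_divide powr_minus_divide)
  finally show ?thesis .
qed

lemma limsup_eq_infinity:
  fixes f :: "nat \<Rightarrow> real"
  assumes "\<And>a N :: nat. \<exists>n\<ge>N. real a < f n"
  shows "limsup (\<lambda>n. ereal (f n)) = \<infinity>"
proof -
  have "(SUP n\<in>{N..}. ereal (f n)) = \<infinity>" for N
  proof (rule SUP_PInfty)
    fix a :: nat
    obtain n where "n \<ge> N" "real a < f n" using assms by blast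
    then show "\<exists>n\<in>{N..}. ereal (real a) \<le> ereal (f n)"
      by (intro bexI[of _ n]) auto
  qed
  then show ?thesis unfolding limsup_INF_SUP by simp
qed

section \<open>Cubes and their codes\<close>

lemma cube_interval_iff_floor:
  fixes x :: real and L :: nat
  assumes "L > 0" "0 \<le> x"
  shows "real k / real L \<le> x \<and> x < (real k + 1) / real L \<longleftrightarrow> k = nat \<lfloor>x * real L\<rfloor>"
proof -
  have "real k / real L \<le> x \<and> x < (real k + 1) / real L \<longleftrightarrow> real k \<le> x * real L \<and> x * real L < real k + 1"
    using assms by (simp add: field_simps)
  also have "\<dots> \<longleftrightarrow> \<lfloor>x * real L\<rfloor> = int k"
    by (auto simp: floor_eq_iff)
  also have "\<dots> \<longleftrightarrow> k = nat \<lfloor>x * real L\<rfloor>"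
    using assms by auto
  finally show ?thesis .
qed

lemma cube_subset_unit_cube:
  fixes I :: "(real ^ 'd) set"
  assumes l: "l > 0" and I: "I \<in> cubes l n"
  shows "I \<subseteq> unit_cube"
proof
  fix x :: "real ^ 'd" assume x: "x \<in> I"
  obtain k :: "'d \<Rightarrow> nat" where k: "\<And>i. k i < l ^ n"
    and I_eq: "I = {x. \<forall>i. real (k i) / real l ^ n \<le> x $ i \<and> x $ i < (real (k i) + 1) / real l ^ n}"
    using I unfolding cubes_def by blast
  have "0 \<le> x $ i \<and> x $ i < 1" for i
  proof -
    have "real (k i) / real l ^ n \<le> x $ i" "x $ i < (real (k i) + 1) / real l ^ n"
      using x unfolding I_eq by auto
    moreover have "(real (k i) + 1) / real l ^ n \<le> 1"
    proof -
      have "real (k i + 1) \<le> real (l ^ n)"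
        using k[of i] by (intro of_nat_mono) simp
      then show ?thesis using l by simp
    qed
    moreover have "0 \<le> real (k i) / real l ^ n" by simp
    ultimately show ?thesis by linarith
  qed
  then show "x \<in> unit_cube" unfolding unit_cube_def by blast
qed

lemma ex1_cube:
  fixes x :: "real ^ 'd"
  assumes l: "l > 0" and x: "x \<in> unit_cube"
  shows "\<exists>!I. I \<in> cubes l n \<and> x \<in> I"
proof -
  have L: "0 < l ^ n" using l by simp
  let ?I = "\<lambda>k :: 'd \<Rightarrow> nat. {x. \<forall>i. real (k i) / real l ^ n \<le> x $ i \<and> x $ i < (real (k i) + 1) / real l ^ n}"
  let ?k = "\<lambda>i. nat \<lfloor>x $ i * real (l ^ n)\<rfloor>"
  have mem: "x \<in> ?I k \<longleftrightarrow> k = ?k" for k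
    using cube_interval_iff_floor[OF L] x unfolding unit_cube_def by (auto simp: fun_eq_iff)
  have "?k i < l ^ n" for i
  proof -
    have "x $ i * real (l ^ n) < 1 * real (l ^ n)"
      using x L unfolding unit_cube_def by (intro mult_strict_right_mono) auto
    then have "\<lfloor>x $ i * real (l ^ n)\<rfloor> < int (l ^ n)"
      by (simp add: floor_less_iff)
    then show ?thesis using L by linarith
  qed
  then have "?I ?k \<in> cubes l n"
    unfolding cubes_def by (intro CollectI exI[of _ ?k] conjI refl) blast
  moreover have "x \<in> ?I ?k" unfolding mem by (rule refl)
  moreover have "J = ?I ?k" if "J \<in> cubes l n" "x \<in> J" for J
  proof -
    obtain k where J: "J = ?I k" using \<open>J \<in> cubes l n\<close> unfolding cubes_def by blast
    then have "k = ?k" using \<open>x \<in> J\<close> mem[of k] by (simp only:)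
    then show ?thesis using J by (simp only:)
  qed
  ultimately show ?thesis by blast
qed

lemma cube_borel:
  fixes I :: "(real ^ 'd) set"
  assumes "I \<in> cubes l n"
  shows "I \<in> sets borel"
proof -
  obtain k :: "'d \<Rightarrow> nat" where
    I_eq: "I = {x. \<forall>i. real (k i) / real l ^ n \<le> x $ i \<and> x $ i < (real (k i) + 1) / real l ^ n}"
    using assms unfolding cubes_def by blast
  show ?thesis unfolding I_eq by measurable
qed

locale coded_quasi_bernoulli = prob_space m
  for m :: "(real ^ 'd) measure" +
  fixes l :: nat and c :: "nat list \<Rightarrow> (real ^ 'd) set" and C :: real
  assumes base: "2 \<le> l"
    and coding: "cube_coding l c"
    and sets_m: "sets m = sets (restrict_space borel unit_cube)"
    and C_ge_1: "1 \<le> C"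
    and quasi_mult:
      "\<And>u v. u \<in> words TYPE('d) l \<Longrightarrow> v \<in> words TYPE('d) l \<Longrightarrow>
        1 / C * measure m (c u) * measure m (c v) \<le> measure m (c (u @ v)) \<and>
        measure m (c (u @ v)) \<le> C * measure m (c u) * measure m (c v)"
begin

definition W :: "nat \<Rightarrow> nat list set" where
  "W n = {w \<in> words TYPE('d) l. length w = n}"

definition mass :: "nat list \<Rightarrow> real" where
  "mass w = measure m (c w)"

lemma finite_W: "finite (W n)"
proof -
  have "W n = {w. set w \<subseteq> {..<l ^ CARD('d)} \<and> length w = n}"
    unfolding W_def words_def by (auto simp: in_lists_conv_set)
  then show ?thesis using finite_lists_length_eq[of "{..<l ^ CARD('d)}" n] by simp
qed

lemma append_in_W: "u \<in> W k \<Longrightarrow> v \<in> W n \<Longrightarrow> u @ v \<in> W (k + n)"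
  unfolding W_def words_def by auto

lemma take_in_W: "w \<in> W n \<Longrightarrow> j \<le> n \<Longrightarrow> take j w \<in> W j"
  unfolding W_def words_def by (auto simp: in_lists_conv_set dest: in_set_takeD)

lemma drop_in_W: "w \<in> W (k + n) \<Longrightarrow> drop k w \<in> W n"
  unfolding W_def words_def by (auto simp: in_lists_conv_set dest: in_set_dropD)

lemma sum_W_add: "sum f (W (k + n)) = (\<Sum>u\<in>W k. \<Sum>v\<in>W n. f (u @ v))"
proof -
  have "bij_betw (\<lambda>(u, v). u @ v) (W k \<times> W n) (W (k + n))"
  proof (rule bij_betw_imageI)
    show "inj_on (\<lambda>(u, v). u @ v) (W k \<times> W n)"
      by (auto simp: inj_on_def W_def)
    show "(\<lambda>(u, v). u @ v) ` (W k \<times> W n) = W (k + n)"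
    proof (intro equalityI subsetI)
      fix w assume w: "w \<in> W (k + n)"
      have "drop k w \<in> W n"
        by (rule drop_in_W[OF w])
      then show "w \<in> (\<lambda>(u, v). u @ v) ` (W k \<times> W n)"
        using take_in_W[OF w, of k] by (intro image_eqI[of _ _ "(take k w, drop k w)"]) auto
    qed (auto intro: append_in_W)
  qed
  from sum.reindex_bij_betw[OF this, of f] show ?thesis
    by (simp add: sum.cartesian_product case_prod_unfold)
qed

lemma space_m: "space m = unit_cube"
  using sets_eq_imp_space_eq[OF sets_m] by (simp add: space_restrict_space)

lemma bij_betw_W_cubes: "bij_betw c (W n) (cubes l n)"
  using coding unfolding cube_coding_def W_def by blast

lemma code_in_cubes: "w \<in> W n \<Longrightarrow> c w \<in> cubes l n"
  using bij_betw_W_cubes bij_betwE by blast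

lemma code_in_sets: "w \<in> W n \<Longrightarrow> c w \<in> sets m"
  using cube_subset_unit_cube[OF _ code_in_cubes] cube_borel[OF code_in_cubes] base
  unfolding sets_m by (subst sets_restrict_space_iff) (auto simp: unit_cube_def)

lemma ex1_code:
  assumes "x \<in> space m"
  shows "\<exists>!w. w \<in> W n \<and> x \<in> c w"
proof -
  have "\<exists>!I. I \<in> cubes l n \<and> x \<in> I"
    using assms base space_m by (intro ex1_cube) auto
  then obtain I where I: "I \<in> cubes l n" "x \<in> I" and uniq: "\<And>J. J \<in> cubes l n \<Longrightarrow> x \<in> J \<Longrightarrow> J = I"
    by blast
  obtain w where w: "w \<in> W n" "I = c w"
    using I(1) bij_betw_W_cubes[of n] unfolding bij_betw_def by blast
  have "v = w" if "v \<in> W n" "x \<in> c v" for v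
    using uniq[OF code_in_cubes[OF that(1)] that(2)] that(1) w bij_betw_W_cubes[of n]
    unfolding bij_betw_def inj_on_def by blast
  then show ?thesis using I(2) w by blast
qed

lemma information_code:
  assumes "w \<in> W n" "x \<in> c w"
  shows "information l m n x = - log (real l) (mass w)"
proof -
  have "x \<in> unit_cube"
    using cube_subset_unit_cube[OF _ code_in_cubes] assms base by fastforce
  then have "\<exists>!I. I \<in> cubes l n \<and> x \<in> I"
    using base by (intro ex1_cube) auto
  then have "cube_at l n x = c w"
    unfolding cube_at_def using assms code_in_cubes by (intro the1_equality) auto
  then show ?thesis unfolding information_def mass_def by simp
qed

lemma code_append_subset: "u @ v \<in> words TYPE('d) l \<Longrightarrow> c (u @ v) \<subseteq> c u"
proof (induction v rule: rev_induct)
  case (snoc a v)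
  have "(u @ v) @ [a] \<in> words TYPE('d) l"
    using snoc.prems by simp
  then have "c ((u @ v) @ [a]) \<subseteq> c (u @ v)"
    using coding unfolding cube_coding_def by blast
  moreover have "u @ v \<in> words TYPE('d) l"
    using snoc.prems unfolding words_def by simp
  ultimately show ?case using snoc.IH by auto
qed simp

lemma code_take_subset: "w \<in> W n \<Longrightarrow> c w \<subseteq> c (take j w)"
  using code_append_subset[of "take j w" "drop j w"] unfolding W_def by simp

lemma mass_nonneg: "0 \<le> mass w"
  unfolding mass_def by simp

lemma measure_Union_codes:
  assumes "A \<subseteq> W n"
  shows "measure m (\<Union>w\<in>A. c w) = sum mass A"
  unfolding mass_def
proof (rule finite_measure_finite_Union)
  show "finite A" using assms finite_W finite_subset by blast
  show "c ` A \<subseteq> events" using assms code_in_sets by auto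
  show "disjoint_family_on c A"
    unfolding disjoint_family_on_def
  proof (intro ballI impI equals0I)
    fix u v x assume "u \<in> A" "v \<in> A" "u \<noteq> v" and x: "x \<in> c u \<inter> c v"
    then have uv: "u \<in> W n" "v \<in> W n" using assms by auto
    have "x \<in> space m" using code_in_sets[OF uv(1)] sets.sets_into_space x by blast
    then show False using ex1_code[of x n] uv x \<open>u \<noteq> v\<close> by blast
  qed
qed

lemma sum_mass: "sum mass (W n) = 1"
proof -
  have "(\<Union>w\<in>W n. c w) = space m"
  proof (intro equalityI subsetI)
    fix x assume "x \<in> space m"
    then show "x \<in> (\<Union>w\<in>W n. c w)" using ex1_code[of x n] by blast
  next
    fix x assume "x \<in> (\<Union>w\<in>W n. c w)"
    then obtain w where "w \<in> W n" "x \<in> c w" by blast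
    then show "x \<in> space m" using code_in_sets[of w n] sets.sets_into_space[of "c w" m] by blast
  qed
  then show ?thesis
    using measure_Union_codes[of "W n" n] prob_space by simp
qed

text \<open>
  The cube of \<open>u\<close> is split by its subcubes, since a point of it lies in some cube of the finer
  generation, which is contained in the cube of its own prefix.
\<close>
lemma sum_mass_append:
  assumes u: "u \<in> W k"
  shows "(\<Sum>v\<in>W n. mass (u @ v)) = mass u"
proof -
  have "c u = (\<Union>w\<in>(@) u ` W n. c w)"
  proof (intro equalityI subsetI)
    fix x assume x: "x \<in> c u"
    then have "x \<in> space m" using code_in_sets[OF u] sets.sets_into_space by blast
    then obtain w where w: "w \<in> W (k + n)" "x \<in> c w" using ex1_code by blast
    then have "take k w = u"
      using ex1_code[OF \<open>x \<in> space m\<close>, of k] code_take_subset[OF w(1), of k] take_in_W[OF w(1), of k] x u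
      by auto
    moreover have "drop k w \<in> W n"
      by (rule drop_in_W[OF w(1)])
    ultimately have "w \<in> (@) u ` W n" by (metis append_take_drop_id image_eqI)
    then show "x \<in> (\<Union>w\<in>(@) u ` W n. c w)" using w(2) by blast
  next
    fix x assume "x \<in> (\<Union>w\<in>(@) u ` W n. c w)"
    then obtain v where "v \<in> W n" "x \<in> c (u @ v)" by blast
    then show "x \<in> c u"
      using append_in_W[OF u] code_append_subset unfolding W_def by blast
  qed
  then have "mass u = measure m (\<Union>w\<in>(@) u ` W n. c w)"
    unfolding mass_def by simp
  also have "\<dots> = sum mass ((@) u ` W n)"
    using append_in_W[OF u] by (intro measure_Union_codes) auto
  also have "\<dots> = (\<Sum>v\<in>W n. mass (u @ v))"
    by (subst sum.reindex) (auto simp: inj_on_def)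
  finally show ?thesis by simp
qed

lemma mass_append_ge: "u \<in> W k \<Longrightarrow> v \<in> W n \<Longrightarrow> mass u * mass v / C \<le> mass (u @ v)"
  and mass_append_le: "u \<in> W k \<Longrightarrow> v \<in> W n \<Longrightarrow> mass (u @ v) \<le> C * (mass u * mass v)"
  using quasi_mult[of u v] unfolding W_def mass_def by (auto simp: algebra_simps)

lemma mass_append_pos_iff:
  assumes "u \<in> W k" "v \<in> W n"
  shows "0 < mass (u @ v) \<longleftrightarrow> 0 < mass u \<and> 0 < mass v"
proof
  assume "0 < mass (u @ v)"
  then have "mass u * mass v \<noteq> 0"
    using mass_append_le[OF assms] by force
  then show "0 < mass u \<and> 0 < mass v"
    using mass_nonneg[of u] mass_nonneg[of v] by auto
next
  assume "0 < mass u \<and> 0 < mass v"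
  then have "0 < mass u * mass v / C" using C_ge_1 by simp
  then show "0 < mass (u @ v)" using mass_append_ge[OF assms] by linarith
qed

lemma log_mass_append:
  assumes uv: "u \<in> W k" "v \<in> W n" and pos: "0 < mass u" "0 < mass v"
  shows "\<bar>log l (mass (u @ v)) - log l (mass u) - log l (mass v)\<bar> \<le> log l C"
proof -
  have l: "1 < real l" using base by simp
  have p: "0 < mass (u @ v)" "0 < C"
    using mass_append_pos_iff[OF uv] pos C_ge_1 by auto
  have "log l (mass u * mass v / C) \<le> log l (mass (u @ v))"
    using l p pos mass_append_ge[OF uv] by (subst log_le_cancel_iff) auto
  moreover have "log l (mass (u @ v)) \<le> log l (C * (mass u * mass v))"
    using l p pos mass_append_le[OF uv] by (subst log_le_cancel_iff) auto
  ultimately show ?thesis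
    using p pos by (simp add: log_mult_pos log_divide_pos abs_le_iff)
qed

section \<open>Partition sums and exponential moments\<close>

definition Z :: "nat \<Rightarrow> real \<Rightarrow> real" where
  "Z n q = (\<Sum>w\<in>W n. mass w powr q)"

text \<open>Cubes of measure zero may be included in the sum because \<open>0 powr q = 0\<close>.\<close>
lemma sum_cubes_eq_Z: "(\<Sum>I\<in>{I \<in> cubes l n. measure m I > 0}. measure m I powr q) = Z n q"
proof -
  have "finite (cubes l n :: (real ^ 'd) set set)"
    using bij_betw_finite[OF bij_betw_W_cubes] finite_W by blast
  then have "(\<Sum>I\<in>{I \<in> cubes l n. measure m I > 0}. measure m I powr q)
      = (\<Sum>I\<in>cubes l n. measure m I powr q)"
    by (intro sum.mono_neutral_left) (auto simp: zero_less_measure_iff)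
  also have "\<dots> = Z n q"
    unfolding Z_def mass_def by (rule sum.reindex_bij_betw[OF bij_betw_W_cubes, symmetric])
  finally show ?thesis .
qed

lemma Z_pos: "0 < Z n q"
proof -
  obtain w where "w \<in> W n" "mass w \<noteq> 0"
    using sum_mass[of n] by (metis sum.neutral zero_neq_one)
  then show ?thesis
    unfolding Z_def using finite_W by (intro sum_pos2[of _ w]) auto
qed

lemma mass_powr_append:
  assumes uv: "u \<in> W k" "v \<in> W n"
  shows "mass (u @ v) powr q \<le> C powr \<bar>q\<bar> * (mass u powr q * mass v powr q)"
    and "mass u powr q * mass v powr q \<le> C powr \<bar>q\<bar> * mass (u @ v) powr q"
proof -
  have "mass (u @ v) powr q \<le> C powr \<bar>q\<bar> * (mass u powr q * mass v powr q) \<and>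
      mass u powr q * mass v powr q \<le> C powr \<bar>q\<bar> * mass (u @ v) powr q"
  proof (cases "0 < mass (u @ v)")
    case False
    then have "mass (u @ v) = 0" "mass u = 0 \<or> mass v = 0"
      using mass_append_pos_iff[OF uv] mass_nonneg[of "u @ v"] mass_nonneg[of u] mass_nonneg[of v]
      by linarith+
    then show ?thesis by auto
  next
    case True
    then have p: "0 < mass u * mass v" using mass_append_pos_iff[OF uv] by simp
    have le: "mass u * mass v / C \<le> mass (u @ v)" "mass (u @ v) \<le> C * (mass u * mass v)"
      using mass_append_ge[OF uv] mass_append_le[OF uv] by auto
    then have "mass (u @ v) / C \<le> mass u * mass v" "mass u * mass v \<le> C * mass (u @ v)"
      using C_ge_1 by (simp_all add: field_simps)
    then show ?thesis
      using powr_within_factor[OF True p C_ge_1 le, of q] powr_within_factor[OF p True C_ge_1, of q]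
      by (simp add: powr_mult mass_nonneg)
  qed
  then show "mass (u @ v) powr q \<le> C powr \<bar>q\<bar> * (mass u powr q * mass v powr q)"
    and "mass u powr q * mass v powr q \<le> C powr \<bar>q\<bar> * mass (u @ v) powr q"
    by blast+
qed

lemma log_Z_almost_additive:
  "\<bar>log l (Z (n + p) q) - log l (Z n q) - log l (Z p q)\<bar> \<le> \<bar>q\<bar> * log l C"
proof -
  have l: "1 < real l" using base by simp
  have prod: "Z n q * Z p q = (\<Sum>u\<in>W n. \<Sum>v\<in>W p. mass u powr q * mass v powr q)"
    unfolding Z_def by (simp add: sum_product)
  have "Z (n + p) q \<le> C powr \<bar>q\<bar> * (Z n q * Z p q)"
    unfolding prod unfolding Z_def sum_W_add sum_distrib_left
    by (intro sum_mono mass_powr_append)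
  then have "log l (Z (n + p) q) \<le> log l (C powr \<bar>q\<bar> * (Z n q * Z p q))"
    using l Z_pos C_ge_1 by (subst log_le_cancel_iff) auto
  moreover have "Z n q * Z p q \<le> C powr \<bar>q\<bar> * Z (n + p) q"
    unfolding prod unfolding Z_def sum_W_add sum_distrib_left
    by (intro sum_mono mass_powr_append)
  then have "log l (Z n q * Z p q) \<le> log l (C powr \<bar>q\<bar> * Z (n + p) q)"
    using l Z_pos C_ge_1 by (subst log_le_cancel_iff) auto
  ultimately show ?thesis
    using Z_pos[of n q] Z_pos[of p q] Z_pos[of "n + p" q] C_ge_1
    by (simp add: log_mult_pos log_powr abs_le_iff)
qed

lemma log_Z_near_spectrum:
  assumes "n > 0"
  shows "\<bar>log l (Z n q) - real n * Lq_spectrum l m q\<bar> \<le> \<bar>q\<bar> * log l C"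
proof -
  have "Lq_spectrum l m q = real_of_ereal (limsup (\<lambda>n. ereal (log l (Z n q) / real n)))"
    unfolding Lq_spectrum_def sum_cubes_eq_Z by (simp add: log_def mult.commute)
  then show ?thesis
    using almost_additive_limsup[of "\<lambda>n. log l (Z n q)" "\<bar>q\<bar> * log l C" n]
      log_Z_almost_additive assms by simp
qed

text \<open>
  The value of \<open>(S\<^sub>n - n d) / \<surd>n\<close> on the cube coded by \<open>w\<close>.
\<close>
definition deviation :: "real \<Rightarrow> nat \<Rightarrow> nat list \<Rightarrow> real" where
  "deviation d n w = (- log l (mass w) - real n * d) / sqrt (real n)"

text \<open>
  The moment is \<open>Z n (1 - q)\<close> up to the normalisation by \<open>n q d\<close>, and \<open>2\<close> bounds \<open>\<bar>1 - q\<bar>\<close>.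
\<close>
lemma log_exp_moment:
  fixes d t :: real
  assumes n: "n > 0" and t: "\<bar>t\<bar> \<le> sqrt (real n)"
  defines "q \<equiv> t / sqrt (real n)"
  defines "M \<equiv> \<Sum>w\<in>W n. mass w * real l powr (t * deviation d n w)"
  shows "0 < M" "\<bar>log l M - real n * (Lq_spectrum l m (1 - q) - q * d)\<bar> \<le> 2 * log l C"
proof -
  have l: "1 < real l" using base by simp
  have "M = (\<Sum>w\<in>W n. real l powr (- (real n * q * d)) * mass w powr (1 - q))"
    unfolding M_def
  proof (rule sum.cong[OF refl])
    fix w assume "w \<in> W n"
    show "mass w * real l powr (t * deviation d n w) = real l powr (- (real n * q * d)) * mass w powr (1 - q)"
    proof (cases "mass w = 0")
      case False
      then have pos: "0 < mass w" using mass_nonneg[of w] by simp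
      have "t * deviation d n w = log l (mass w) * (- q) + - (real n * q * d)"
        unfolding deviation_def q_def by (simp add: diff_divide_distrib algebra_simps)
      then have "real l powr (t * deviation d n w) = mass w powr (- q) * real l powr (- (real n * q * d))"
        using l pos by (simp only: powr_add powr_powr[symmetric]) simp
      then show ?thesis
        using powr_mult_base[of "mass w" "- q"] pos by simp
    qed simp
  qed
  then have M_eq: "M = real l powr (- (real n * q * d)) * Z n (1 - q)"
    unfolding Z_def by (simp add: sum_distrib_left)
  then show "0 < M" using Z_pos l by simp
  have "log l M = - (real n * q * d) + log l (Z n (1 - q))"
    unfolding M_eq using Z_pos[of n "1 - q"] l by (simp add: log_mult_pos)
  moreover have "\<bar>q\<bar> \<le> 1"
    using t n unfolding q_def by (simp add: abs_divide)
  then have "\<bar>1 - q\<bar> * log l C \<le> 2 * log l C"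
    using C_ge_1 l by (intro mult_right_mono) auto
  ultimately show "\<bar>log l M - real n * (Lq_spectrum l m (1 - q) - q * d)\<bar> \<le> 2 * log l C"
    using log_Z_near_spectrum[OF n, of "1 - q"] by (simp add: algebra_simps)
qed

text \<open>
  As \<open>n\<close> tends to infinity with \<open>q = t / \<surd>n\<close>, the expansion of the spectrum gives
  \<open>n (\<tau>(1 - q) - q d) \<approx> \<sigma>\<^sup>2 t\<^sup>2 / 2\<close>, so up to a bounded factor the moments are those of a Gaussian law; the weaker constants \<open>1/4\<close> and \<open>3/4\<close> absorb
  the remainder of the expansion.
\<close>
lemma gaussian_exp_moments:
  assumes \<sigma>: "\<sigma> > 0"
    and expansion: "(\<lambda>q. Lq_spectrum l m (1 - q) - (q * d + \<sigma>\<^sup>2 / 2 * q\<^sup>2)) \<in> o[at 0](\<lambda>q. q\<^sup>2)"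
    and t: "t \<noteq> 0"
  shows "\<forall>\<^sub>F n in sequentially.
    real l powr (\<sigma>\<^sup>2 / 4 * t\<^sup>2 - 2 * log l C) \<le> (\<Sum>w\<in>W n. mass w * real l powr (t * deviation d n w)) \<and>
    (\<Sum>w\<in>W n. mass w * real l powr (t * deviation d n w)) \<le> real l powr (3 * \<sigma>\<^sup>2 / 4 * t\<^sup>2 + 2 * log l C)"
proof -
  have l: "1 < real l" using base by simp
  have "\<forall>\<^sub>F q in at 0. norm (Lq_spectrum l m (1 - q) - (q * d + \<sigma>\<^sup>2 / 2 * q\<^sup>2)) \<le> \<sigma>\<^sup>2 / 4 * norm (q\<^sup>2)"
    using landau_o.smallD[OF expansion, of "\<sigma>\<^sup>2 / 4"] \<sigma> by simp
  moreover have "filterlim (\<lambda>n. t / sqrt (real n)) (at 0) sequentially"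
  proof (rule filterlim_atI)
    show "(\<lambda>n. t / sqrt (real n)) \<longlonglongrightarrow> 0"
      by (intro real_tendsto_divide_at_top[OF tendsto_const]
          filterlim_compose[OF sqrt_at_top filterlim_real_sequentially])
    show "\<forall>\<^sub>F n in sequentially. t / sqrt (real n) \<noteq> 0"
      using eventually_gt_at_top[of "0::nat"] by eventually_elim (simp add: t)
  qed
  ultimately have "\<forall>\<^sub>F n in sequentially.
      norm (Lq_spectrum l m (1 - t / sqrt (real n)) - (t / sqrt (real n) * d + \<sigma>\<^sup>2 / 2 * (t / sqrt (real n))\<^sup>2))
        \<le> \<sigma>\<^sup>2 / 4 * norm ((t / sqrt (real n))\<^sup>2)"
    by (rule eventually_compose_filterlim)
  moreover have "\<forall>\<^sub>F n in sequentially. \<bar>t\<bar> \<le> sqrt (real n)"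
    using filterlim_compose[OF sqrt_at_top filterlim_real_sequentially]
    unfolding filterlim_at_top by blast
  ultimately show ?thesis
    using eventually_gt_at_top[of 0]
  proof eventually_elim
    case (elim n)
    let ?q = "t / sqrt (real n)"
    let ?M = "\<Sum>w\<in>W n. mass w * real l powr (t * deviation d n w)"
    let ?e = "Lq_spectrum l m (1 - ?q) - ?q * d"
    have q2: "?q\<^sup>2 = t\<^sup>2 / real n" by (simp add: power_divide)
    have "\<bar>?e - \<sigma>\<^sup>2 / 2 * (t\<^sup>2 / real n)\<bar> \<le> \<sigma>\<^sup>2 / 4 * (t\<^sup>2 / real n)"
      using elim(1) unfolding q2 by (simp add: algebra_simps)
    then have "real n * \<bar>?e - \<sigma>\<^sup>2 / 2 * (t\<^sup>2 / real n)\<bar> \<le> real n * (\<sigma>\<^sup>2 / 4 * (t\<^sup>2 / real n))"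
      by (rule mult_left_mono) simp
    moreover have "real n * \<bar>?e - \<sigma>\<^sup>2 / 2 * (t\<^sup>2 / real n)\<bar> = \<bar>real n * (?e - \<sigma>\<^sup>2 / 2 * (t\<^sup>2 / real n))\<bar>"
      by (simp add: abs_mult)
    moreover have "real n * (?e - \<sigma>\<^sup>2 / 2 * (t\<^sup>2 / real n)) = real n * ?e - \<sigma>\<^sup>2 / 2 * t\<^sup>2"
      "real n * (\<sigma>\<^sup>2 / 4 * (t\<^sup>2 / real n)) = \<sigma>\<^sup>2 / 4 * t\<^sup>2"
      using elim(3) by (simp_all add: right_diff_distrib)
    ultimately have "\<bar>real n * ?e - \<sigma>\<^sup>2 / 2 * t\<^sup>2\<bar> \<le> \<sigma>\<^sup>2 / 4 * t\<^sup>2" by metis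
    moreover note log_exp_moment(2)[OF elim(3,2), of d]
    moreover have "D / 4 * r - k \<le> x" "x \<le> 3 * D / 4 * r + k"
      if "\<bar>y - D / 2 * r\<bar> \<le> D / 4 * r" "\<bar>x - y\<bar> \<le> k" for D r k x y :: real
      using that by linarith+
    ultimately have "\<sigma>\<^sup>2 / 4 * t\<^sup>2 - 2 * log l C \<le> log l ?M" "log l ?M \<le> 3 * \<sigma>\<^sup>2 / 4 * t\<^sup>2 + 2 * log l C"
      by blast+
    then show ?case
      using log_exp_moment(1)[OF elim(3,2), of d] l by (simp add: le_log_iff log_le_iff)
  qed
qed

section \<open>Large deviations of both signs\<close>

text \<open>
  The sign \<open>s = 1\<close> selects large positive and \<open>s = -1\<close> large negative deviations.
\<close>
definition tail_words :: "real \<Rightarrow> real \<Rightarrow> real \<Rightarrow> nat \<Rightarrow> nat list set" where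
  "tail_words d s a n = {w \<in> W n. 0 < mass w \<and> a < s * deviation d n w}"

text \<open>
  For large \<open>t\<close> the moment of order \<open>t\<close> is of order \<open>exp (const * t\<^sup>2)\<close> and exceeds the contribution
  \<open>exp (const * t * a)\<close> of the values below \<open>a\<close>, while the moment of order \<open>2 * t\<close> stays bounded
  in \<open>n\<close>.
\<close>
lemma tail_mass_bounded_below:
  assumes \<sigma>: "\<sigma> > 0"
    and expansion: "(\<lambda>q. Lq_spectrum l m (1 - q) - (q * d + \<sigma>\<^sup>2 / 2 * q\<^sup>2)) \<in> o[at 0](\<lambda>q. q\<^sup>2)"
    and a: "0 \<le> a" and s: "\<bar>s\<bar> = 1"
  shows "\<exists>\<delta>>0. \<forall>\<^sub>F n in sequentially. \<delta> \<le> sum mass (tail_words d s a n)"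
proof -
  have l: "1 < real l" using base by simp
  define K where "K = 2 * log l C"
  have K: "0 \<le> K" unfolding K_def using l C_ge_1 by simp
  \<comment> \<open>With this \<open>t\<close> the moment of order \<open>t\<close> is at least \<open>2 * l powr (t * a)\<close>, that is twice the
    contribution of the values below \<open>a\<close>.\<close>
  define t where "t = 1 + 4 * (a + K + 1) / \<sigma>\<^sup>2"
  have t: "1 \<le> t" unfolding t_def using a K by simp
  have "a + K + 1 \<le> \<sigma>\<^sup>2 / 4 * t" unfolding t_def using \<sigma> by (simp add: field_simps)
  then have "(a + K + 1) * t \<le> \<sigma>\<^sup>2 / 4 * t * t"
    using t by (intro mult_right_mono) auto
  moreover have "K + 1 \<le> (K + 1) * t" using t K by simp
  ultimately have t_large: "t * a + 1 \<le> \<sigma>\<^sup>2 / 4 * t\<^sup>2 - K"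
    by (simp add: algebra_simps power2_eq_square)
  have s2: "s\<^sup>2 = 1" "s \<noteq> 0" using s by (auto simp: abs_square_eq_1)
  define B where "B = real l powr (3 * \<sigma>\<^sup>2 / 4 * (2 * t)\<^sup>2 + K)"
  have B: "0 < B" unfolding B_def using l by simp
  have first: "\<forall>\<^sub>F n in sequentially.
      real l powr (\<sigma>\<^sup>2 / 4 * t\<^sup>2 - K) \<le> (\<Sum>w\<in>W n. mass w * real l powr (s * t * deviation d n w))"
    using gaussian_exp_moments[OF \<sigma> expansion, of "s * t"] t s2
    by (simp add: K_def power_mult_distrib eventually_conj_iff)
  have second: "\<forall>\<^sub>F n in sequentially.
      (\<Sum>w\<in>W n. mass w * real l powr (s * (2 * t) * deviation d n w)) \<le> B"
    using gaussian_exp_moments[OF \<sigma> expansion, of "s * (2 * t)"] t s2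
    by (simp add: K_def B_def power_mult_distrib eventually_conj_iff)
  have "\<forall>\<^sub>F n in sequentially. 1 / B \<le> sum mass (tail_words d s a n)"
    using first second
  proof eventually_elim
    case (elim n)
    let ?z = "\<lambda>w. real l powr (s * t * deviation d n w)"
    let ?b = "real l powr (t * a)"
    have "2 * ?b \<le> real l powr 1 * ?b"
      using base by (intro mult_right_mono) auto
    also have "\<dots> = real l powr (t * a + 1)" by (simp only: powr_add mult.commute)
    also have "\<dots> \<le> real l powr (\<sigma>\<^sup>2 / 4 * t\<^sup>2 - K)"
      using t_large l by (intro powr_mono) auto
    finally have mean: "2 * ?b \<le> (\<Sum>w\<in>W n. mass w * ?z w)" using elim(1) by linarith
    have "?b < ?z w \<longleftrightarrow> a < s * deviation d n w" for w
    proof -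
      have "?b < ?z w \<longleftrightarrow> t * a < t * (s * deviation d n w)"
        using l by (simp add: mult.assoc mult.left_commute)
      then show ?thesis using t by simp
    qed
    then have tail: "sum mass {w \<in> W n. ?b < ?z w} = sum mass (tail_words d s a n)"
      unfolding tail_words_def using finite_W mass_nonneg
      by (intro sum.mono_neutral_right) (auto simp: order_less_le)
    have "(?z w)\<^sup>2 = real l powr (s * (2 * t) * deviation d n w)" for w
      using l by (simp add: powr_power mult_ac)
    then have sq: "(\<Sum>w\<in>W n. mass w * (?z w)\<^sup>2) \<le> B" using elim(2) by simp
    have "1 \<le> ?b" using l t a by (intro ge_one_powr_ge_zero) auto
    then have "1 \<le> ?b\<^sup>2" by (rule one_le_power)
    also have "\<dots> \<le> (\<Sum>w\<in>W n. mass w * (?z w)\<^sup>2) * sum mass (tail_words d s a n)"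
      using second_moment_tail[OF finite_W mass_nonneg _ _ mean] sum_mass[of n] unfolding tail by simp
    also have "\<dots> \<le> B * sum mass (tail_words d s a n)"
      using sq by (intro mult_right_mono sum_nonneg mass_nonneg)
    finally show ?case using B by (simp add: divide_le_eq mult.commute)
  qed
  then show ?thesis using B by (intro exI[of _ "1 / B"]) auto
qed

text \<open>
  A fixed prefix \<open>u\<close> changes \<open>S\<^sub>n - n d\<close> only by a bounded amount, which is negligible on the scale
  \<open>\<surd>n\<close>; raising the threshold by one pays for it.
\<close>
lemma append_tail_word:
  assumes u: "u \<in> W k" "0 < mass u" and a: "0 \<le> a" and s: "\<bar>s\<bar> = 1"
  shows "\<forall>\<^sub>F n in sequentially. \<forall>v\<in>tail_words d s (a + 1) n. u @ v \<in> tail_words d s a (k + n)"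
proof -
  define R where "R = a * sqrt (real k) + \<bar>log l (mass u)\<bar> + log l C + real k * \<bar>d\<bar>"
  have "\<forall>\<^sub>F n in sequentially. R \<le> sqrt (real n)"
    using filterlim_compose[OF sqrt_at_top filterlim_real_sequentially]
    unfolding filterlim_at_top by blast
  then show ?thesis
    using eventually_gt_at_top[of 0]
  proof eventually_elim
    case (elim n)
    show ?case
    proof
      fix v assume "v \<in> tail_words d s (a + 1) n"
      then have v: "v \<in> W n" "0 < mass v" and dev: "a + 1 < s * deviation d n v"
        unfolding tail_words_def by auto
      let ?S = "\<lambda>w n. - log l (mass w) - real n * d"
      have "(a + 1) * sqrt (real n) < s * ?S v n"
        using dev elim(2) unfolding deviation_def by (simp add: less_divide_eq)
      moreover have "s * ?S v n - (\<bar>log l (mass u)\<bar> + log l C + real k * \<bar>d\<bar>) \<le> s * ?S (u @ v) (k + n)"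
      proof -
        have diff: "?S v n - ?S (u @ v) (k + n)
            = (log l (mass (u @ v)) - log l (mass u) - log l (mass v)) + log l (mass u) + real k * d"
          by (simp add: algebra_simps)
        have "s * ?S v n - s * ?S (u @ v) (k + n) \<le> \<bar>s * (?S v n - ?S (u @ v) (k + n))\<bar>"
          by (simp add: right_diff_distrib)
        also have "\<dots> = \<bar>(log l (mass (u @ v)) - log l (mass u) - log l (mass v)) + log l (mass u) + real k * d\<bar>"
          unfolding diff abs_mult s by simp
        also have "\<dots> \<le> log l C + \<bar>log l (mass u)\<bar> + \<bar>real k * d\<bar>"
          using log_mass_append[OF u(1) v(1) u(2) v(2)] by linarith
        finally show ?thesis by (simp add: abs_mult)
      qed
      moreover have "a * sqrt (real (k + n)) \<le> a * (sqrt (real k) + sqrt (real n))"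
        using a sqrt_add_le_add_sqrt[of "real k" "real n"] by (intro mult_left_mono) auto
      ultimately have "a * sqrt (real (k + n)) < s * ?S (u @ v) (k + n)"
        using elim(1) unfolding R_def by (simp add: algebra_simps)
      then have "a < s * deviation d (k + n) (u @ v)"
        using elim(2) unfolding deviation_def by (simp add: less_divide_eq)
      then show "u @ v \<in> tail_words d s a (k + n)"
        unfolding tail_words_def using append_in_W[OF u(1) v(1)] mass_append_pos_iff[OF u(1) v(1)] u v by simp
    qed
  qed
qed

text \<open>
  The quasi-Bernoulli property makes the bound of \<open>tail_mass_bounded_below\<close> hold conditionally on
  every cube, with the same constant for all of them.
\<close>
lemma conditional_tail_mass:
  assumes \<sigma>: "\<sigma> > 0"
    and expansion: "(\<lambda>q. Lq_spectrum l m (1 - q) - (q * d + \<sigma>\<^sup>2 / 2 * q\<^sup>2)) \<in> o[at 0](\<lambda>q. q\<^sup>2)"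
    and a: "0 \<le> a" and s: "\<bar>s\<bar> = 1"
  shows "\<exists>\<epsilon>>0. \<forall>k. \<forall>u\<in>W k. \<forall>\<^sub>F n in sequentially.
    \<epsilon> * mass u \<le> (\<Sum>v\<in>{v \<in> W n. u @ v \<in> tail_words d s a (k + n)}. mass (u @ v))"
proof -
  obtain \<delta> where \<delta>: "0 < \<delta>" "\<forall>\<^sub>F n in sequentially. \<delta> \<le> sum mass (tail_words d s (a + 1) n)"
    using tail_mass_bounded_below[OF \<sigma> expansion _ s, of "a + 1"] a by auto
  have "\<forall>\<^sub>F n in sequentially.
      \<delta> / C * mass u \<le> (\<Sum>v\<in>{v \<in> W n. u @ v \<in> tail_words d s a (k + n)}. mass (u @ v))"
    if u: "u \<in> W k" for k u
  proof (cases "0 < mass u")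
    case False
    then have "mass u = 0" using mass_nonneg[of u] by simp
    then show ?thesis by (simp add: sum_nonneg mass_nonneg)
  next
    case True
    show ?thesis
      using \<delta>(2) append_tail_word[OF u True a s, of d]
    proof eventually_elim
      case (elim n)
      have sub: "tail_words d s (a + 1) n \<subseteq> {v \<in> W n. u @ v \<in> tail_words d s a (k + n)}"
        using elim(2) unfolding tail_words_def by auto
      have "\<delta> / C * mass u = mass u / C * \<delta>" by simp
      also have "\<dots> \<le> mass u / C * sum mass (tail_words d s (a + 1) n)"
        using elim(1) True C_ge_1 by (intro mult_left_mono) auto
      also have "\<dots> = (\<Sum>v\<in>tail_words d s (a + 1) n. mass u * mass v / C)"
        by (simp add: sum_distrib_left)
      also have "\<dots> \<le> (\<Sum>v\<in>tail_words d s (a + 1) n. mass (u @ v))"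
        using u by (intro sum_mono mass_append_ge) (auto simp: tail_words_def)
      also have "\<dots> \<le> (\<Sum>v\<in>{v \<in> W n. u @ v \<in> tail_words d s a (k + n)}. mass (u @ v))"
        using sub finite_W mass_nonneg by (intro sum_mono2) auto
      finally show ?case .
    qed
  qed
  then show ?thesis
    using \<delta>(1) C_ge_1 by (intro exI[of _ "\<delta> / C"]) auto
qed

section \<open>Infinitely many visits\<close>

text \<open>
  Let \<open>S k\<close> be the words of length \<open>k\<close> that have avoided \<open>H\<close> from time \<open>N\<close> on.  Going from \<open>k\<close>
  to a later generation, chosen uniformly for the finitely many words of length \<open>k\<close>, removes at
  least the proportion \<open>\<epsilon>\<close> of the mass of \<open>S k\<close>.  So the mass of the points which avoid \<open>H\<close> forever
  is at most \<open>(1 - \<epsilon>) ^ i\<close> for every \<open>i\<close>.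
\<close>
lemma AE_visits_infinitely_often:
  assumes \<epsilon>: "0 < \<epsilon>" "\<epsilon> \<le> 1" and H: "\<And>n. H n \<subseteq> W n"
    and visit: "\<And>k u. u \<in> W k \<Longrightarrow> \<forall>\<^sub>F n in sequentially.
      \<epsilon> * mass u \<le> (\<Sum>v\<in>{v \<in> W n. u @ v \<in> H (k + n)}. mass (u @ v))"
  shows "AE x in m. \<forall>N. \<exists>n\<ge>N. x \<in> (\<Union>w\<in>H n. c w)"
proof (subst AE_all_countable, rule allI)
  fix N :: nat
  define S where "S k = {w \<in> W k. \<forall>n\<in>{N..k}. take n w \<notin> H n}" for k
  define B where "B = space m - (\<Union>n\<in>{N..}. \<Union>w\<in>H n. c w)"
  have H_code: "c w \<in> sets m" if "w \<in> H n" for w n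
    using H[of n] that code_in_sets by blast
  have H_sets: "(\<Union>w\<in>H n. c w) \<in> sets m" for n
    using finite_subset[OF H finite_W] H_code by (intro sets.finite_UN) auto
  have B_sets: "B \<in> sets m"
    unfolding B_def using H_sets by (intro sets.compl_sets sets.countable_UN') auto
  have B_le: "measure m B \<le> sum mass (S k)" for k
  proof -
    have "B \<subseteq> (\<Union>w\<in>S k. c w)"
    proof
      fix x assume x: "x \<in> B"
      then obtain w where w: "w \<in> W k" "x \<in> c w"
        using ex1_code[of x k] unfolding B_def by blast
      have "take n w \<notin> H n" if "n \<in> {N..k}" for n
        using x code_take_subset[OF w(1), of n] w(2) that unfolding B_def by auto
      then show "x \<in> (\<Union>w\<in>S k. c w)" using w unfolding S_def by blast
    qed
    moreover have "S k \<subseteq> W k" unfolding S_def by auto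
    moreover from this have "(\<Union>w\<in>S k. c w) \<in> sets m"
      using finite_subset[OF _ finite_W] code_in_sets by (intro sets.finite_UN) auto
    ultimately show ?thesis
      using finite_measure_mono measure_Union_codes by metis
  qed
  have "\<exists>k\<ge>N. sum mass (S k) \<le> (1 - \<epsilon>) ^ i" for i
  proof (induction i)
    case 0
    have "sum mass (S N) \<le> sum mass (W N)"
      using finite_W mass_nonneg by (intro sum_mono2) (auto simp: S_def)
    then show ?case using sum_mass[of N] by auto
  next
    case (Suc i)
    then obtain k where k: "k \<ge> N" "sum mass (S k) \<le> (1 - \<epsilon>) ^ i" by blast
    have "\<forall>\<^sub>F n in sequentially. \<forall>u\<in>W k.
        \<epsilon> * mass u \<le> (\<Sum>v\<in>{v \<in> W n. u @ v \<in> H (k + n)}. mass (u @ v))"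
      using visit finite_W by (intro eventually_ball_finite) auto
    then obtain n where n: "\<And>u. u \<in> W k \<Longrightarrow>
        \<epsilon> * mass u \<le> (\<Sum>v\<in>{v \<in> W n. u @ v \<in> H (k + n)}. mass (u @ v))"
      unfolding eventually_sequentially by blast
    have stay: "(\<Sum>v\<in>{v \<in> W n. u @ v \<notin> H (k + n)}. mass (u @ v)) \<le> (1 - \<epsilon>) * mass u"
      if u: "u \<in> W k" for u
    proof -
      have "(\<Sum>v\<in>W n. mass (u @ v)) = (\<Sum>v\<in>{v \<in> W n. u @ v \<in> H (k + n)}. mass (u @ v))
          + (\<Sum>v\<in>{v \<in> W n. u @ v \<notin> H (k + n)}. mass (u @ v))"
        using finite_W by (subst sum.union_disjoint[symmetric]) (auto intro: sum.cong)
      then show ?thesis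
        using n[OF u] sum_mass_append[OF u, of n] by (simp add: algebra_simps)
    qed
    have "sum mass (S (k + n)) \<le> sum mass ((\<lambda>(u, v). u @ v) ` (SIGMA u:S k. {v \<in> W n. u @ v \<notin> H (k + n)}))"
    proof (rule sum_mono2)
      show "finite ((\<lambda>(u, v). u @ v) ` (SIGMA u:S k. {v \<in> W n. u @ v \<notin> H (k + n)}))"
        using finite_W by (intro finite_imageI finite_SigmaI) (auto simp: S_def)
      show "S (k + n) \<subseteq> (\<lambda>(u, v). u @ v) ` (SIGMA u:S k. {v \<in> W n. u @ v \<notin> H (k + n)})"
      proof
        fix w assume w: "w \<in> S (k + n)"
        then have wW: "w \<in> W (k + n)" unfolding S_def by simp
        have "take k w \<in> S k"
        proof -
          have "take j (take k w) \<notin> H j" if "j \<in> {N..k}" for j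
            using w that unfolding S_def by (auto simp: min_def)
          then show ?thesis using take_in_W[OF wW, of k] unfolding S_def by auto
        qed
        moreover have "drop k w \<in> W n"
          by (rule drop_in_W[OF wW])
        moreover have "w \<notin> H (k + n)"
          using w wW k(1) unfolding S_def W_def by (auto dest: bspec[of _ _ "k + n"])
        ultimately show "w \<in> (\<lambda>(u, v). u @ v) ` (SIGMA u:S k. {v \<in> W n. u @ v \<notin> H (k + n)})"
          by (intro image_eqI[of _ _ "(take k w, drop k w)"]) auto
      qed
    qed (simp add: mass_nonneg)
    also have "\<dots> = (\<Sum>(u, v)\<in>(SIGMA u:S k. {v \<in> W n. u @ v \<notin> H (k + n)}). mass (u @ v))"
      by (subst sum.reindex) (auto simp: inj_on_def S_def W_def case_prod_unfold)
    also have "\<dots> = (\<Sum>u\<in>S k. \<Sum>v\<in>{v \<in> W n. u @ v \<notin> H (k + n)}. mass (u @ v))"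
      using finite_W by (intro sum.Sigma[symmetric]) (auto simp: S_def)
    also have "\<dots> \<le> (\<Sum>u\<in>S k. (1 - \<epsilon>) * mass u)"
      using stay by (intro sum_mono) (auto simp: S_def)
    also have "\<dots> = (1 - \<epsilon>) * sum mass (S k)"
      by (simp add: sum_distrib_left)
    also have "\<dots> \<le> (1 - \<epsilon>) * (1 - \<epsilon>) ^ i"
      using k(2) \<epsilon> by (intro mult_left_mono) auto
    finally show ?case using k(1) by (intro exI[of _ "k + n"]) auto
  qed
  then have "measure m B \<le> (1 - \<epsilon>) ^ i" for i
    using B_le order_trans by blast
  moreover have "(\<lambda>i. (1 - \<epsilon>) ^ i) \<longlonglongrightarrow> 0"
    using \<epsilon> by (intro LIMSEQ_power_zero) auto
  ultimately have "measure m B \<le> 0"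
    by (intro LIMSEQ_le_const) auto
  then have "B \<in> null_sets m"
    using B_sets measure_nonneg[of m B] by (intro null_setsI) (auto simp: emeasure_eq_measure)
  then show "AE x in m. \<exists>n\<ge>N. x \<in> (\<Union>w\<in>H n. c w)"
    by (rule AE_I') (auto simp: B_def)
qed

lemma AE_limsup_deviation:
  assumes \<sigma>: "\<sigma> > 0"
    and expansion: "(\<lambda>q. Lq_spectrum l m (1 - q) - (q * d + \<sigma>\<^sup>2 / 2 * q\<^sup>2)) \<in> o[at 0](\<lambda>q. q\<^sup>2)"
    and s: "\<bar>s\<bar> = 1"
  shows "AE x in m. limsup (\<lambda>n. ereal (s * ((information l m n x - real n * d) / sqrt (real n)))) = \<infinity>"
proof -
  have "AE x in m. \<forall>N. \<exists>n\<ge>N. x \<in> (\<Union>w\<in>tail_words d s (real a) n. c w)" for a :: nat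
  proof -
    obtain \<epsilon> where \<epsilon>: "0 < \<epsilon>" "\<And>k u. u \<in> W k \<Longrightarrow> \<forall>\<^sub>F n in sequentially.
        \<epsilon> * mass u \<le> (\<Sum>v\<in>{v \<in> W n. u @ v \<in> tail_words d s a (k + n)}. mass (u @ v))"
      using conditional_tail_mass[OF \<sigma> expansion _ s, of "real a"] by auto
    have "\<forall>\<^sub>F n in sequentially. min 1 \<epsilon> * mass u
        \<le> (\<Sum>v\<in>{v \<in> W n. u @ v \<in> tail_words d s a (k + n)}. mass (u @ v))"
      if "u \<in> W k" for k u
      using \<epsilon>(2)[OF that]
    proof eventually_elim
      case (elim n)
      have "min 1 \<epsilon> * mass u \<le> \<epsilon> * mass u"
        by (intro mult_right_mono mass_nonneg) simp
      then show ?case using elim by linarith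
    qed
    then show ?thesis
      using \<epsilon>(1) by (intro AE_visits_infinitely_often[of "min 1 \<epsilon>"]) (auto simp: tail_words_def)
  qed
  then have "AE x in m. \<forall>a :: nat. \<forall>N. \<exists>n\<ge>N. x \<in> (\<Union>w\<in>tail_words d s (real a) n. c w)"
    by (subst AE_all_countable) blast
  then show ?thesis
  proof (rule AE_mp, intro AE_I2 impI)
    fix x assume visits: "\<forall>a :: nat. \<forall>N. \<exists>n\<ge>N. x \<in> (\<Union>w\<in>tail_words d s (real a) n. c w)"
    show "limsup (\<lambda>n. ereal (s * ((information l m n x - real n * d) / sqrt (real n)))) = \<infinity>"
    proof (rule limsup_eq_infinity)
      fix a N :: nat
      obtain n w where n: "n \<ge> N" and w: "w \<in> tail_words d s (real a) n" "x \<in> c w"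
        using visits by blast
      then have "real a < s * ((information l m n x - real n * d) / sqrt (real n))"
        using information_code[of w n x] unfolding tail_words_def deviation_def by simp
      then show "\<exists>n\<ge>N. real a < s * ((information l m n x - real n * d) / sqrt (real n))"
        using n by blast
    qed
  qed
qed

end

theorem theorem4p7:
  fixes l :: nat
    and c :: "nat list \<Rightarrow> (real ^ 'd) set"
    and m :: "(real ^ 'd) measure"
    and d \<sigma> :: real
  assumes "l \<ge> 2"
    and "cube_coding l c"
    and "quasi_bernoulli l c m"
    and "d = - deriv (Lq_spectrum l m) 1"
    and "\<sigma> > 0"
    and "(\<lambda>q. Lq_spectrum l m (1 - q) - (q * d + \<sigma>\<^sup>2 / 2 * q\<^sup>2)) \<in> o[at 0](\<lambda>q. q\<^sup>2)"
  shows "AE x in m.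
    limsup (\<lambda>n. ereal ((information l m n x - real n * d) / sqrt (real n))) = \<infinity> \<and>
    liminf (\<lambda>n. ereal ((information l m n x - real n * d) / sqrt (real n))) = - \<infinity>"
proof -
  obtain C where "coded_quasi_bernoulli m l c C"
    using assms(1-3)
    unfolding quasi_bernoulli_def borel_prob_unit_cube_def
      coded_quasi_bernoulli_def coded_quasi_bernoulli_axioms_def by blast
  then interpret coded_quasi_bernoulli m l c C .
  let ?X = "\<lambda>n x. (information l m n x - real n * d) / sqrt (real n)"
  have "AE x in m. limsup (\<lambda>n. ereal (1 * ?X n x)) = \<infinity>"
    by (rule AE_limsup_deviation[OF assms(5,6)]) simp
  moreover have "AE x in m. limsup (\<lambda>n. ereal (- 1 * ?X n x)) = \<infinity>"
    by (rule AE_limsup_deviation[OF assms(5,6)]) simp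
  ultimately show ?thesis
  proof eventually_elim
    case (elim x)
    have "(\<lambda>n. ereal (- 1 * ?X n x)) = (\<lambda>n. - ereal (?X n x))"
      by (simp only: mult_minus1 uminus_ereal.simps)
    then have "- liminf (\<lambda>n. ereal (?X n x)) = \<infinity>"
      using elim(2) by (simp only: ereal_Limsup_uminus)
    then have "liminf (\<lambda>n. ereal (?X n x)) = - \<infinity>"
      by (metis ereal_uminus_uminus)
    then show ?case using elim(1) by simp
  qed
qed

end
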